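(* Let $G$ be a graph of order at least two. Suppose $\{\mathrm{diam}(G),\mathrm{diam}(\overline{G})\}\ne\{3\}$ (i.e. it is not the case that $\mathrm{diam}(G)=\mathrm{diam}(\overline{G})=3$) and $\mathrm{diam}(G)\le\mathrm{diam}(\overline{G})$. Then $\mathrm{Sd}_f(G,\overline{G})=\dim_f(G)$.
   Context: Graphs are finite, simple and undirected, and need not be connected. $\overline{G}$ is the complement of $G$ (on the same vertex set). $d_G(x,y)$ is the least number of edges on a path joining $x$ and $y$ in $G$ ($\infty$ if there is none), and $\mathrm{diam}(G)=\max\{d_G(x,y):x,y\in V(G)\}$ (possibly $\infty$). For distinct $x,y\in V(G)$, $R_G\{x,y\}=\{z\in V(G): d_G(x,z)\ne d_G(y,z)\}$. For a function $g$ on $V$ and $U\subseteq V$, $g(U)=\sum_{s\in U}g(s)$. A resolving function of $G$ is a function $g:V(G)\to[0,1]$ with $g(R_G\{x,y\})\ge 1$ for all distinct $x,y\in V(G)$; the fractional dimension $\dim_f(G)$ is the minimum of $g(V(G))$ over all resolving functions $g$ of $G$. $\mathrm{Sd}_f(G,\overline{G})$ is the minimum of $g(V(G))$ over all functions $g:V(G)\to[0,1]$ that are resolving functions of both $G$ and $\overline{G}$. *)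

theory Defs
  imports
    "HOL-Analysis.Analysis"
    "HOL-Library.Extended_Nat"
    "Graph_Theory.Graph_Theory"
begin

text \<open>
  Finite simple undirected graphs are the loop-free symmetric finite digraphs of the locale
  \<^locale>\<open>pair_graph\<close>: each edge is represented by its two opposite arcs.
\<close>

definition graph_complement :: "'a pair_pre_digraph \<Rightarrow> 'a pair_pre_digraph" where
  "graph_complement G =
     \<lparr> pverts = pverts G,
       parcs = {(x, y). x \<in> pverts G \<and> y \<in> pverts G \<and> x \<noteq> y \<and> (x, y) \<notin> parcs G} \<rparr>"

text \<open>A path is a list of arcs, so its length is its number of edges;
  the infimum over the empty set is \<open>\<infinity>\<close>.\<close>

definition graph_dist :: "'a pair_pre_digraph \<Rightarrow> 'a \<Rightarrow> 'a \<Rightarrow> enat" where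
  "graph_dist G x y = (INF p \<in> {p. pre_digraph.apath (with_proj G) x p y}. enat (length p))"

definition graph_diam :: "'a pair_pre_digraph \<Rightarrow> enat" where
  "graph_diam G = Max {graph_dist G x y | x y. x \<in> pverts G \<and> y \<in> pverts G}"

definition resolving_set :: "'a pair_pre_digraph \<Rightarrow> 'a \<Rightarrow> 'a \<Rightarrow> 'a set" where
  "resolving_set G x y = {z \<in> pverts G. graph_dist G x z \<noteq> graph_dist G y z}"

text \<open>Only the values of \<open>g\<close> on the vertex set matter.\<close>

definition resolving_function :: "'a pair_pre_digraph \<Rightarrow> ('a \<Rightarrow> real) \<Rightarrow> bool" where
  "resolving_function G g \<longleftrightarrow>
     (\<forall>v \<in> pverts G. 0 \<le> g v \<and> g v \<le> 1) \<and>
     (\<forall>x \<in> pverts G. \<forall>y \<in> pverts G. x \<noteq> y \<longrightarrow> 1 \<le> sum g (resolving_set G x y))"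

text \<open>The infima below are attained for finite graphs; see \<open>frac_dim_attained\<close> and
  \<open>sim_frac_dim_attained\<close>.\<close>

definition frac_dim :: "'a pair_pre_digraph \<Rightarrow> real" where
  "frac_dim G = Inf {sum g (pverts G) | g. resolving_function G g}"

text \<open>Intended for two graphs on the same vertex set.\<close>

definition sim_frac_dim :: "'a pair_pre_digraph \<Rightarrow> 'a pair_pre_digraph \<Rightarrow> real" where
  "sim_frac_dim G H =
     Inf {sum g (pverts G) | g. resolving_function G g \<and> resolving_function H g}"

lemma pair_graph_complement:
  assumes "pair_graph G"
  shows "pair_graph (graph_complement G)"
proof -
  interpret pair_graph G by fact
  let ?A = "parcs (graph_complement G)"
  have fin: "finite (pverts G)" by (rule pair_finite_verts)
  have sub: "?A \<subseteq> pverts G \<times> pverts G" by (auto simp: graph_complement_def)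
  have s: "sym (parcs G)" using pair_sym_arcs by (simp add: symmetric_def)
  have "sym ?A" using s by (auto simp: graph_complement_def sym_def)
  then show ?thesis
    using fin finite_subset[OF sub] sub
    by unfold_locales (auto simp: graph_complement_def symmetric_def)
qed

lemma graph_dist_self:
  assumes "x \<in> pverts G"
  shows "graph_dist G x x = 0"
proof -
  have "pre_digraph.apath (with_proj G) x [] x"
    using assms by (simp add: pre_digraph.apath_def pre_digraph.awalk_def cas_with_proj_eq
        awalk_verts_with_proj_eq)
  then have "graph_dist G x x \<le> enat (length ([] :: ('a \<times> 'a) list))"
    unfolding graph_dist_def by (intro INF_lower) simp
  then show ?thesis by (simp add: enat_0)
qed

lemma graph_dist_pos:
  assumes "x \<noteq> y"
  shows "graph_dist G x y \<noteq> 0"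
proof -
  have "1 \<le> enat (length p)" if "pre_digraph.apath (with_proj G) x p y" for p
    using that assms
    by (cases p) (auto simp: pre_digraph.apath_def pre_digraph.awalk_def cas_with_proj_eq one_enat_def)
  then have "1 \<le> graph_dist G x y"
    unfolding graph_dist_def by (intro INF_greatest) auto
  then show ?thesis by auto
qed

lemma resolving_function_const_1:
  assumes "finite (pverts G)"
  shows "resolving_function G (\<lambda>_. 1)"
proof -
  have "1 \<le> card (resolving_set G x y)"
    if "x \<in> pverts G" "y \<in> pverts G" "x \<noteq> y" for x y
  proof -
    have "x \<in> resolving_set G x y"
      using that graph_dist_self[of x G] graph_dist_pos[of y x G]
      by (auto simp: resolving_set_def)
    moreover have "finite (resolving_set G x y)"
      using assms by (simp add: resolving_set_def)
    ultimately show ?thesis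
      by (metis One_nat_def Suc_leI card_gt_0_iff empty_iff)
  qed
  then show ?thesis by (force simp: resolving_function_def)
qed

lemma sim_frac_dim_attained:
  assumes fin: "finite (pverts G)" and same: "pverts H = pverts G"
  shows "\<exists>g. resolving_function G g \<and> resolving_function H g \<and>
             sum g (pverts G) = sim_frac_dim G H"
    and "\<lbrakk>resolving_function G f; resolving_function H f\<rbrakk> \<Longrightarrow>
           sim_frac_dim G H \<le> sum f (pverts G)"
proof -
  let ?V = "pverts G"
  let ?P = "\<lambda>g. resolving_function G g \<and> resolving_function H g"
  let ?S = "{sum g ?V | g. ?P g}"
  define B where "B = (\<Pi>\<^sub>E v\<in>(UNIV :: 'a set). if v \<in> ?V then {0..1::real} else {0})"
  define C where "C K = (\<Inter>x\<in>?V. \<Inter>y\<in>?V - {x}. {g :: 'a \<Rightarrow> real. 1 \<le> sum g (resolving_set K x y)})"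
    for K :: "'a pair_pre_digraph"
  have "compactin (product_topology (\<lambda>_. euclidean) UNIV) B"
    unfolding B_def compactin_PiE by auto
  then have comp: "compact B" by (simp add: euclidean_product_topology)
  have cl: "closed (C K)" for K
    unfolding C_def by (intro closed_INT ballI closed_Collect_le continuous_intros) auto
  have compS: "compact (B \<inter> (C G \<inter> C H))"
    by (intro compact_Int_closed comp closed_Int cl)
  have in_iff: "g \<in> B \<inter> (C G \<inter> C H) \<longleftrightarrow> ?P g \<and> (\<forall>v. v \<notin> ?V \<longrightarrow> g v = 0)" for g
    using same unfolding B_def C_def resolving_function_def
    by (auto simp: PiE_iff split: if_splits)
  define r where "r g v = (if v \<in> ?V then g v else 0)" for g :: "'a \<Rightarrow> real" and v
  have rsum: "sum (r g) A = sum g A" if "A \<subseteq> ?V" for g A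
    using that by (intro sum.cong) (auto simp: r_def)
  have res_sub: "resolving_set G x y \<subseteq> ?V" "resolving_set H x y \<subseteq> ?V" for x y
    using same by (auto simp: resolving_set_def)
  have r_in: "r g \<in> B \<inter> (C G \<inter> C H)" if "?P g" for g
  proof -
    have "?P (r g)"
      using that same unfolding resolving_function_def
      by (simp add: rsum res_sub) (simp add: r_def)
    then show ?thesis unfolding in_iff by (simp add: r_def)
  qed
  have one: "?P (\<lambda>_. 1)"
    using resolving_function_const_1[of G] resolving_function_const_1[of H] fin same by simp
  have ne: "B \<inter> (C G \<inter> C H) \<noteq> {}" using r_in[OF one] by blast
  have cont: "continuous_on (B \<inter> (C G \<inter> C H)) (\<lambda>g. sum g ?V)"
    by (intro continuous_intros continuous_on_subset[OF continuous_on_product_coordinates]) auto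
  obtain m where m: "m \<in> B \<inter> (C G \<inter> C H)"
    and least: "\<And>g. g \<in> B \<inter> (C G \<inter> C H) \<Longrightarrow> sum m ?V \<le> sum g ?V"
    using continuous_attains_inf[OF compS ne cont] by blast
  have Pm: "?P m" using m in_iff by blast
  have le: "sum m ?V \<le> sum g ?V" if "?P g" for g
    using least[OF r_in[OF that]] by (simp add: rsum)
  have eq: "sim_frac_dim G H = sum m ?V"
    unfolding sim_frac_dim_def by (rule cInf_eq_minimum) (use Pm le in auto)
  show "\<exists>g. resolving_function G g \<and> resolving_function H g \<and> sum g ?V = sim_frac_dim G H"
    using Pm eq by auto
  show "\<lbrakk>resolving_function G f; resolving_function H f\<rbrakk> \<Longrightarrow> sim_frac_dim G H \<le> sum f ?V"
    using le eq by auto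
qed

lemma frac_dim_attained:
  assumes "finite (pverts G)"
  shows "\<exists>g. resolving_function G g \<and> sum g (pverts G) = frac_dim G"
    and "resolving_function G f \<Longrightarrow> frac_dim G \<le> sum f (pverts G)"
proof -
  have "frac_dim G = sim_frac_dim G G" by (simp add: frac_dim_def sim_frac_dim_def)
  then show "\<exists>g. resolving_function G g \<and> sum g (pverts G) = frac_dim G"
    and "resolving_function G f \<Longrightarrow> frac_dim G \<le> sum f (pverts G)"
    using sim_frac_dim_attained[OF assms refl] by auto
qed

end

theory Submission
  imports Defs
begin

text \<open>
  In a graph of diameter at most two, the distance of two vertices only records whether they are
  equal, adjacent, or neither. Complementation exchanges the last two cases, so a vertex that
  resolves a pair in \<open>G\<close> also resolves it in the complement: the resolving sets of \<open>G\<close> are contained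
  in those of the complement (\<open>resolving_set_subset_complement\<close>). Hence every resolving function of
  \<open>G\<close> is one of the complement, and both infima range over the same set.

  The hypotheses on the diameters force this situation. If \<open>G\<close> has diameter at least three, then it
  has two nonadjacent vertices without a common neighbour; in the complement these dominate all
  vertices and are adjacent, so the complement has diameter at most three
  (\<open>complement_dist_le_3\<close>). Since the diameter of \<open>G\<close> is the smaller one, both would be three.
\<close>

lemma (in wf_digraph) length_awalk_to_apath:
  assumes "awalk u p v"
  shows "length (awalk_to_apath p) \<le> length p"
  using assms
proof (induct rule: awalk_to_apath_induct)
  case (path p)
  then have "awalk_to_apath p = p" by (auto simp: awalk_to_apath.simps)
  then show ?case by simp
next
  case (decomp p q r s)
  then have "p = q @ r @ s" by (auto elim: awalk_cyc_decompE)
  then show ?case using decomp step_awalk_to_apath[of _ p _ q r s] by simp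
qed

lemma (in pair_wf_digraph) graph_dist_le_awalk:
  assumes "awalk x p y"
  shows "graph_dist G x y \<le> enat (length p)"
proof -
  have "graph_dist G x y \<le> enat (length (awalk_to_apath p))"
    unfolding graph_dist_def using apath_awalk_to_apath[OF assms] by (intro INF_lower) simp
  also have "\<dots> \<le> enat (length p)" using length_awalk_to_apath[OF assms] by simp
  finally show ?thesis .
qed

lemma (in pair_wf_digraph) graph_dist_attained:
  assumes "graph_dist G x y = enat n"
  obtains p where "awalk x p y" "length p = n"
proof -
  let ?L = "(\<lambda>p. enat (length p)) ` {p. apath x p y}"
  have "?L \<noteq> {}"
  proof
    assume "?L = {}"
    then have "graph_dist G x y = \<infinity>" by (simp add: graph_dist_def Inf_enat_def)
    then show False using assms by simp
  qed
  then have "Inf ?L \<in> ?L" unfolding Inf_enat_def by (metis LeastI ex_in_conv)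
  then have "enat n \<in> ?L" using assms unfolding graph_dist_def by simp
  then show thesis using that by (auto simp: apath_def)
qed

lemma (in pair_wf_digraph) graph_dist_triangle:
  "graph_dist G x z \<le> graph_dist G x y + graph_dist G y z"
proof (cases "graph_dist G x y = \<infinity> \<or> graph_dist G y z = \<infinity>")
  case True
  then show ?thesis by auto
next
  case False
  then obtain m n where mn: "graph_dist G x y = enat m" "graph_dist G y z = enat n" by auto
  obtain p q where p: "awalk x p y" "length p = m" and q: "awalk y q z" "length q = n"
    using mn by (auto elim!: graph_dist_attained)
  show ?thesis
    using graph_dist_le_awalk[OF awalk_appendI[OF p(1) q(1)]] p q mn by simp
qed

lemma (in pair_loopfree_digraph) graph_dist_eq_1_iff:
  "graph_dist G x y = 1 \<longleftrightarrow> (x, y) \<in> parcs G"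
proof
  assume "graph_dist G x y = 1"
  then obtain p where "awalk x p y" "length p = 1"
    using graph_dist_attained[of x y 1] by (auto simp: one_enat_def)
  then show "(x, y) \<in> parcs G"
    by (auto simp: length_Suc_conv awalk_simps)
next
  assume a: "(x, y) \<in> parcs G"
  then have "awalk x [(x, y)] y" using arc_implies_awalk[of "(x, y)"] by simp
  then have "graph_dist G x y \<le> enat (length [(x, y)])" by (rule graph_dist_le_awalk)
  then have "graph_dist G x y \<le> 1" by (simp add: one_enat_def)
  moreover have "graph_dist G x y \<noteq> 0" using pair_no_loops[OF a] by (simp add: graph_dist_pos)
  ultimately show "graph_dist G x y = 1"
    by (cases "graph_dist G x y") (auto simp: one_enat_def zero_enat_def)
qed

text \<open>The vertices \<open>x\<close> and \<open>y\<close> share no neighbour in \<open>G\<close>, so in the complement each vertex is equal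
  or adjacent to one of them; as \<open>x\<close> and \<open>y\<close> are themselves adjacent there, any two vertices are
  joined by a walk through them with at most three edges.\<close>

lemma (in pair_graph) complement_dist_le_3:
  assumes x: "x \<in> pverts G" and y: "y \<in> pverts G" and far: "\<not> graph_dist G x y \<le> 2"
    and u: "u \<in> pverts G" and v: "v \<in> pverts G"
  shows "graph_dist (graph_complement G) u v \<le> 3"
proof -
  let ?H = "graph_complement G"
  interpret H: pair_graph ?H by (rule pair_graph_complement) (rule pair_graph)
  have sym: "(b, a) \<in> parcs G" if "(a, b) \<in> parcs G" for a b
    using that pair_sym_arcs by (auto simp: symmetric_def elim: symE)
  have close: "graph_dist ?H a b \<le> 1"
    if "a \<in> pverts G" "b \<in> pverts G" "(a, b) \<notin> parcs G" for a b
  proof (cases "a = b")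
    case True
    then show ?thesis using that graph_dist_self[of a ?H] by (simp add: graph_complement_def)
  next
    case False
    then have "(a, b) \<in> parcs ?H" using that by (simp add: graph_complement_def)
    then have "graph_dist ?H a b = 1" by (simp only: H.graph_dist_eq_1_iff)
    then show ?thesis by simp
  qed
  have nonadj: "(x, y) \<notin> parcs G"
  proof
    assume "(x, y) \<in> parcs G"
    then have "graph_dist G x y = 1" by (simp add: graph_dist_eq_1_iff)
    then show False using far by (simp add: one_enat_def numeral_eq_enat)
  qed
  have no_common: "(x, w) \<notin> parcs G \<or> (w, y) \<notin> parcs G" for w
    using graph_dist_triangle[of x y w] far graph_dist_eq_1_iff[of x w] graph_dist_eq_1_iff[of w y]
    by auto
  have dominated: "\<exists>c \<in> {x, y}. graph_dist ?H w c \<le> 1 \<and> graph_dist ?H c w \<le> 1"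
    if "w \<in> pverts G" for w
    using no_common[of w] close that x y sym by blast
  obtain a where a: "a \<in> {x, y}" "graph_dist ?H u a \<le> 1" using dominated[OF u] by blast
  obtain b where b: "b \<in> {x, y}" "graph_dist ?H b v \<le> 1" using dominated[OF v] by blast
  have "(a, b) \<notin> parcs G"
    using a(1) b(1) nonadj sym[of y x] pair_no_loops[of "(x, x)"] pair_no_loops[of "(y, y)"] by auto
  then have ab: "graph_dist ?H a b \<le> 1" using close[of a b] a(1) b(1) x y by auto
  have "graph_dist ?H u v \<le> graph_dist ?H u a + graph_dist ?H a v"
    by (rule H.graph_dist_triangle)
  also have "\<dots> \<le> graph_dist ?H u a + (graph_dist ?H a b + graph_dist ?H b v)"
    by (intro add_left_mono H.graph_dist_triangle)
  also have "\<dots> \<le> 1 + (1 + 1)" by (intro add_mono a b ab)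
  finally show ?thesis by simp
qed

text \<open>If \<open>z\<close> is neither \<open>x\<close> nor \<open>y\<close> and resolves them in \<open>G\<close>, then its two distances are \<open>1\<close> and \<open>2\<close>,
  so exactly one of \<open>x\<close> and \<open>y\<close> is adjacent to \<open>z\<close>. Then the same holds in the complement, where
  exactly one of the distances is \<open>1\<close>.\<close>

lemma (in pair_graph) resolving_set_subset_complement:
  assumes diam: "\<And>u v. u \<in> pverts G \<Longrightarrow> v \<in> pverts G \<Longrightarrow> graph_dist G u v \<le> 2"
    and x: "x \<in> pverts G" and y: "y \<in> pverts G"
  shows "resolving_set G x y \<subseteq> resolving_set (graph_complement G) x y"
proof
  let ?H = "graph_complement G"
  interpret H: pair_graph ?H by (rule pair_graph_complement) (rule pair_graph)
  fix z
  assume "z \<in> resolving_set G x y"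
  then have z: "z \<in> pverts G" and ne: "graph_dist G x z \<noteq> graph_dist G y z"
    by (auto simp: resolving_set_def)
  have zH: "z \<in> pverts ?H" using z by (simp add: graph_complement_def)
  have "graph_dist ?H x z \<noteq> graph_dist ?H y z"
  proof (cases "z = x \<or> z = y")
    case True
    moreover have "x \<noteq> y" using ne by blast
    ultimately show ?thesis
      using graph_dist_self[OF zH] graph_dist_pos[of x z ?H] graph_dist_pos[of y z ?H] by auto
  next
    case False
    have dist: "graph_dist G w z = (if (w, z) \<in> parcs G then 1 else 2)"
      if "w \<in> pverts G" "w \<noteq> z" for w
    proof -
      have "d = 1 \<or> d = 2" if "d \<le> 2" "d \<noteq> 0" for d :: enat
        using that by (cases d) (auto simp: numeral_eq_enat one_enat_def zero_enat_def)
      then show ?thesis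
        using diam[OF that(1) z] graph_dist_pos[OF that(2), of G] graph_dist_eq_1_iff[of w z] by auto
    qed
    have "(x, z) \<in> parcs G \<longleftrightarrow> (y, z) \<notin> parcs G"
      using ne dist[OF x] dist[OF y] False by (auto split: if_splits)
    then have "(x, z) \<in> parcs ?H \<longleftrightarrow> (y, z) \<notin> parcs ?H"
      using False x y z by (auto simp: graph_complement_def)
    then show ?thesis by (metis H.graph_dist_eq_1_iff)
  qed
  then show "z \<in> resolving_set ?H x y" using zH by (simp add: resolving_set_def)
qed

lemma resolving_function_mono:
  assumes "resolving_function G g" and fin: "finite (pverts G)" and same: "pverts H = pverts G"
    and sub: "\<And>x y. x \<in> pverts G \<Longrightarrow> y \<in> pverts G \<Longrightarrow> resolving_set G x y \<subseteq> resolving_set H x y"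
  shows "resolving_function H g"
proof -
  have "1 \<le> sum g (resolving_set H x y)" if "x \<in> pverts G" "y \<in> pverts G" "x \<noteq> y" for x y
  proof -
    have "1 \<le> sum g (resolving_set G x y)" using assms(1) that by (simp add: resolving_function_def)
    also have "\<dots> \<le> sum g (resolving_set H x y)"
      using sub[OF that(1,2)] assms(1) fin same
      by (intro sum_mono2) (auto simp: resolving_function_def resolving_set_def)
    finally show ?thesis .
  qed
  then show ?thesis using assms(1) same by (simp add: resolving_function_def)
qed

lemma graph_diam_le_iff:
  assumes "finite (pverts G)" and "pverts G \<noteq> {}"
  shows "graph_diam G \<le> n \<longleftrightarrow> (\<forall>x \<in> pverts G. \<forall>y \<in> pverts G. graph_dist G x y \<le> n)"
proof -
  have "{graph_dist G x y | x y. x \<in> pverts G \<and> y \<in> pverts G} =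
      (\<lambda>(x, y). graph_dist G x y) ` (pverts G \<times> pverts G)" by auto
  then show ?thesis using assms by (auto simp: graph_diam_def)
qed

theorem theorem3p7:
  fixes G :: "'a pair_pre_digraph"
  assumes "pair_graph G"
    and "card (pverts G) \<ge> 2"
    and "{graph_diam G, graph_diam (graph_complement G)} \<noteq> {3}"
    and "graph_diam G \<le> graph_diam (graph_complement G)"
  shows "sim_frac_dim G (graph_complement G) = frac_dim G"
proof -
  let ?H = "graph_complement G"
  interpret pair_graph G by fact
  have fin: "finite (pverts G)" by (rule pair_finite_verts)
  have ne: "pverts G \<noteq> {}" using assms(2) by auto
  have same: "pverts ?H = pverts G" by (simp add: graph_complement_def)
  have "graph_diam G \<le> 2"
  proof (rule ccontr)
    assume big: "\<not> graph_diam G \<le> 2"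
    then obtain x y where "x \<in> pverts G" "y \<in> pverts G" "\<not> graph_dist G x y \<le> 2"
      using graph_diam_le_iff[OF fin ne] by blast
    then have "graph_diam ?H \<le> 3"
      using graph_diam_le_iff[of ?H 3] complement_dist_le_3 fin ne same by simp
    moreover have "3 \<le> graph_diam G"
      using big by (cases "graph_diam G") (auto simp: numeral_eq_enat)
    ultimately have "graph_diam G = 3 \<and> graph_diam ?H = 3" using assms(4) by auto
    then show False using assms(3) by simp
  qed
  then have "resolving_set G x y \<subseteq> resolving_set ?H x y"
    if "x \<in> pverts G" "y \<in> pverts G" for x y
    using graph_diam_le_iff[OF fin ne] resolving_set_subset_complement that by simp
  then have "resolving_function ?H g" if "resolving_function G g" for g
    using resolving_function_mono[OF that fin same] by blast
  then show ?thesis unfolding sim_frac_dim_def frac_dim_def by metis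
qed

end
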